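(* Under the standing assumptions on $f,h,X,\rho,\mu,\nu,G_h$ listed in the context, let $x\in\mathcal{T}_1=\{x\in X:\operatorname{dist}(x;\mathcal{X}^* )<(\mu/(\rho G_h))^{1/\nu}\}$ be a stationary point of the problem $\min_{x\in X}f(x)$, i.e. $0\in\partial(f+\delta_X)(x)$. Then $x\in\mathcal{X}^*$.
   Context: Notation: $\|\cdot\|$ is the Euclidean norm on $\mathbb{R}^n$, $\operatorname{dist}(x;S)=\inf_{z\in S}\|z-x\|$, $\operatorname{proj}_S(x)=\operatorname{argmin}_{z\in S}\|z-x\|$ (a set in general), $\delta_X$ is the indicator function of $X$ ($0$ on $X$, $+\infty$ elsewhere). For a function $\varphi$ finite at $x$, $\partial\varphi(x)$ is the Fréchet subdifferential: all $\zeta$ with $\varphi(y)\ge\varphi(x)+\langle\zeta,y-x\rangle+o(\|y-x\|)$ as $y\to x$. Standing assumptions: $h:\mathbb{R}^n\to\mathbb{R}\cup\{+\infty\}$ is a Legendre kernel: proper, lower semicontinuous, strictly convex, continuously differentiable on $\operatorname{int}\operatorname{dom}(h)\ne\emptyset$, and essentially smooth ($\|\nabla h(x_k)\|\to\infty$ whenever $x_k\in\operatorname{int}\operatorname{dom}(h)$ converges to a boundary point of $\operatorname{dom}(h)$). $D_h(x,y)=h(x)-h(y)-\langle\nabla h(y),x-y\rangle$ for $y\in\operatorname{int}\operatorname{dom}(h)$. $X\subseteq\operatorname{int}\operatorname{dom}(h)$ is nonempty, closed and convex. $f:\mathbb{R}^n\to\mathbb{R}\cup\{+\infty\}$ is proper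 (not assumed differentiable), $\rho>0$, and $f+\rho h$ is convex on $\operatorname{int}\operatorname{dom}(h)$ ($f$ is $\rho$-weakly convex relative to $h$); $f$ is finite and locally Lipschitz around every point of $X$. $f^*:=\inf_Xf>-\infty$ and $\mathcal{X}^*:=\{x\in X:f(x)=f^*\}\neq\emptyset$. Sharpness: $\mu>0$ and $\mu\operatorname{dist}(x;\mathcal{X}^* )\le f(x)-f^*$ for all $x\in X$. Local Bregman growth: $\nu\in(0,1]$, $G_h>0$ and $\inf_{y\in\operatorname{proj}_{\mathcal{X}^*}(x)}D_h(y,x)\le G_h\operatorname{dist}^{1+\nu}(x;\mathcal{X}^* )$ for all $x\in X$ with $\operatorname{dist}(x;\mathcal{X}^* )<(\mu/(\rho G_h))^{1/\nu}$. *)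

theory Defs
  imports "HOL-Analysis.Analysis" "HOL-Library.Landau_Symbols"
begin

definition eff_dom :: "('a \<Rightarrow> ereal) \<Rightarrow> 'a set" where
  "eff_dom \<phi> = {x. \<phi> x < \<infinity>}"

definition proper_fun :: "('a \<Rightarrow> ereal) \<Rightarrow> bool" where
  "proper_fun \<phi> \<longleftrightarrow> (\<forall>x. \<phi> x \<noteq> -\<infinity>) \<and> eff_dom \<phi> \<noteq> {}"

definition lower_semicontinuous :: "('a::topological_space \<Rightarrow> ereal) \<Rightarrow> bool" where
  "lower_semicontinuous \<phi> \<longleftrightarrow> (\<forall>x. \<phi> x \<le> Liminf (at x) \<phi>)"

(* Convexity of an extended-valued function on a set. It is applied only to functions that never
   take the value -\<infinity>, so no sum below has the form \<infinity> + (-\<infinity>). *)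
definition econvex_on :: "'a::real_vector set \<Rightarrow> ('a \<Rightarrow> ereal) \<Rightarrow> bool" where
  "econvex_on S \<phi> \<longleftrightarrow> convex S \<and>
     (\<forall>x\<in>S. \<forall>y\<in>S. \<forall>t. 0 < t \<and> t < 1 \<longrightarrow>
        \<phi> ((1 - t) *\<^sub>R x + t *\<^sub>R y) \<le> ereal (1 - t) * \<phi> x + ereal t * \<phi> y)"

(* The strict inequality also makes the effective domain convex. *)
definition strictly_econvex :: "('a::real_vector \<Rightarrow> ereal) \<Rightarrow> bool" where
  "strictly_econvex \<phi> \<longleftrightarrow>
     (\<forall>x\<in>eff_dom \<phi>. \<forall>y\<in>eff_dom \<phi>. \<forall>t. x \<noteq> y \<and> 0 < t \<and> t < 1 \<longrightarrow>
        \<phi> ((1 - t) *\<^sub>R x + t *\<^sub>R y) < ereal (1 - t) * \<phi> x + ereal t * \<phi> y)"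

(* Meaningful at points where \<phi> is finite nearby and differentiable; the gradient is then unique. *)
definition grad :: "('a::real_inner \<Rightarrow> ereal) \<Rightarrow> 'a \<Rightarrow> 'a" where
  "grad \<phi> x = (SOME g. GDERIV (\<lambda>y. real_of_ereal (\<phi> y)) x :> g)"

definition continuously_differentiable_on_int_dom :: "('a::real_inner \<Rightarrow> ereal) \<Rightarrow> bool" where
  "continuously_differentiable_on_int_dom \<phi> \<longleftrightarrow>
     (\<forall>x\<in>interior (eff_dom \<phi>). \<exists>g. GDERIV (\<lambda>y. real_of_ereal (\<phi> y)) x :> g) \<and>
     continuous_on (interior (eff_dom \<phi>)) (grad \<phi>)"

definition essentially_smooth :: "('a::real_inner \<Rightarrow> ereal) \<Rightarrow> bool" where
  "essentially_smooth \<phi> \<longleftrightarrow>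
     (\<forall>u z. (\<forall>k::nat. u k \<in> interior (eff_dom \<phi>)) \<and> z \<in> frontier (eff_dom \<phi>) \<and> u \<longlonglongrightarrow> z
        \<longrightarrow> filterlim (\<lambda>k. norm (grad \<phi> (u k))) at_top sequentially)"

definition legendre_kernel :: "('a::real_inner \<Rightarrow> ereal) \<Rightarrow> bool" where
  "legendre_kernel h \<longleftrightarrow>
     proper_fun h \<and> lower_semicontinuous h \<and> strictly_econvex h \<and>
     interior (eff_dom h) \<noteq> {} \<and> continuously_differentiable_on_int_dom h \<and>
     essentially_smooth h"

definition bregman :: "('a::real_inner \<Rightarrow> ereal) \<Rightarrow> 'a \<Rightarrow> 'a \<Rightarrow> ereal" where
  "bregman h x y = h x - h y - ereal (inner (grad h y) (x - y))"

definition relatively_weakly_convex ::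
    "real \<Rightarrow> ('a::real_normed_vector \<Rightarrow> ereal) \<Rightarrow> ('a \<Rightarrow> ereal) \<Rightarrow> bool" where
  "relatively_weakly_convex \<rho> h f \<longleftrightarrow>
     econvex_on (interior (eff_dom h)) (\<lambda>x. f x + ereal \<rho> * h x)"

definition finite_locally_lipschitz_at :: "('a::metric_space \<Rightarrow> ereal) \<Rightarrow> 'a \<Rightarrow> bool" where
  "finite_locally_lipschitz_at f x \<longleftrightarrow>
     (\<exists>e>0. \<exists>L. (\<forall>y\<in>ball x e. \<bar>f y\<bar> \<noteq> \<infinity>) \<and>
        L-lipschitz_on (ball x e) (\<lambda>y. real_of_ereal (f y)))"

definition proj_set :: "'a::metric_space set \<Rightarrow> 'a \<Rightarrow> 'a set" where
  "proj_set S x = {z. is_arg_min (\<lambda>z. dist z x) (\<lambda>z. z \<in> S) z}"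

definition indicator_fun :: "'a set \<Rightarrow> 'a \<Rightarrow> ereal" where
  "indicator_fun X x = (if x \<in> X then 0 else \<infinity>)"

(* Empty at points where \<phi> is not finite. *)
definition frechet_subdifferential :: "('a::real_inner \<Rightarrow> ereal) \<Rightarrow> 'a \<Rightarrow> 'a set" where
  "frechet_subdifferential \<phi> x =
     {\<zeta>. \<bar>\<phi> x\<bar> \<noteq> \<infinity> \<and>
        (\<exists>r. r \<in> o[at x](\<lambda>y. norm (y - x)) \<and>
          (\<forall>\<^sub>F y in at x. \<phi> y \<ge> \<phi> x + ereal (inner \<zeta> (y - x)) + ereal (r y)))}"

definition stationary_point :: "('a::real_inner \<Rightarrow> ereal) \<Rightarrow> 'a set \<Rightarrow> 'a \<Rightarrow> bool" where
  "stationary_point f X x \<longleftrightarrow>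
     0 \<in> frechet_subdifferential (\<lambda>y. f y + indicator_fun X y) x"

definition opt_value :: "('a \<Rightarrow> ereal) \<Rightarrow> 'a set \<Rightarrow> ereal" where
  "opt_value f X = (INF x\<in>X. f x)"

definition sol_set :: "('a \<Rightarrow> ereal) \<Rightarrow> 'a set \<Rightarrow> 'a set" where
  "sol_set f X = {x \<in> X. f x = opt_value f X}"

definition sharp :: "real \<Rightarrow> ('a::metric_space \<Rightarrow> ereal) \<Rightarrow> 'a set \<Rightarrow> bool" where
  "sharp \<mu> f X \<longleftrightarrow>
     (\<forall>x\<in>X. ereal (\<mu> * infdist x (sol_set f X)) \<le> f x - opt_value f X)"

definition tube ::
    "('a::metric_space \<Rightarrow> ereal) \<Rightarrow> 'a set \<Rightarrow> real \<Rightarrow> real \<Rightarrow> real \<Rightarrow> real \<Rightarrow> 'a set" where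
  "tube f X \<rho> \<mu> \<nu> G =
     {x \<in> X. infdist x (sol_set f X) < (\<mu> / (\<rho> * G)) powr (1 / \<nu>)}"

definition local_bregman_growth ::
    "('a::real_inner \<Rightarrow> ereal) \<Rightarrow> ('a \<Rightarrow> ereal) \<Rightarrow> 'a set \<Rightarrow> real \<Rightarrow> real \<Rightarrow> real \<Rightarrow> real \<Rightarrow> bool" where
  "local_bregman_growth h f X \<rho> \<mu> \<nu> G \<longleftrightarrow>
     (\<forall>x\<in>tube f X \<rho> \<mu> \<nu> G.
        (INF y\<in>proj_set (sol_set f X) x. bregman h y x)
          \<le> ereal (G * infdist x (sol_set f X) powr (1 + \<nu>)))"

end

theory Submission
  imports Defs
begin

text \<open>
  Convexity of \<open>f + \<rho> h\<close> along the segment from a stationary point \<open>x\<close> to a projection \<open>y\<close> of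
  \<open>x\<close> onto the solution set, combined with the first-order lower bound on \<open>f\<close> at \<open>x\<close>, gives
  \<open>f x - f y \<le> \<rho> D\<^sub>h(y, x)\<close>.  With sharpness and Bregman growth, \<open>d = dist(x; X\<^sup>*)\<close> satisfies
  \<open>\<mu> d \<le> \<rho> G d\<^bsup>1 + \<nu>\<^esup>\<close>, which inside the tube forces \<open>d = 0\<close>.
\<close>

text \<open>Insert the lower bound on \<open>F\<close> into the convexity inequality, divide by
  \<open>t\<close> and let \<open>t\<close> tend to 0 from the right: the remainder quotient
  vanishes and the difference quotient of \<open>H\<close> tends to \<open>inner g (y - x)\<close>.
  All hypotheses concern the segment only, so extended values do not enter.\<close>

lemma stationary_segment_real:
  fixes F H :: "'a::real_inner \<Rightarrow> real"
  assumes der: "GDERIV H x :> g"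
    and conv: "\<And>t. 0 < t \<Longrightarrow> t < 1 \<Longrightarrow>
      F ((1 - t) *\<^sub>R x + t *\<^sub>R y) + \<rho> * H ((1 - t) *\<^sub>R x + t *\<^sub>R y)
        \<le> (1 - t) * (F x + \<rho> * H x) + t * (F y + \<rho> * H y)"
    and r: "r \<in> o[at x](\<lambda>z. norm (z - x))"
    and ev: "\<forall>\<^sub>F t in at_right 0. F ((1 - t) *\<^sub>R x + t *\<^sub>R y) \<ge> F x + r ((1 - t) *\<^sub>R x + t *\<^sub>R y)"
    and lim: "filterlim (\<lambda>t. (1 - t) *\<^sub>R x + t *\<^sub>R y) (at x) (at_right (0::real))"
  shows "F x - F y \<le> \<rho> * (H y - H x - inner g (y - x))"
proof -
  define c where "c = (\<lambda>t::real. (1 - t) *\<^sub>R x + t *\<^sub>R y)"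
  have c_eq: "c t = x + t *\<^sub>R (y - x)" for t
    by (simp add: c_def algebra_simps)
  \<comment> \<open>Composing with the segment turns the little-o at \<open>x\<close> into one in
    \<open>t\<close>, because \<open>norm (c t - x)\<close> is linear in \<open>t\<close>.\<close>
  have "(\<lambda>t. r (c t)) \<in> o[at_right 0](\<lambda>t. norm (c t - x))"
    using landau_o.small.compose[OF r lim] by (simp add: c_def)
  also have "(\<lambda>t. norm (c t - x)) \<in> O[at_right 0](\<lambda>t. t)"
    by (rule bigoI[of _ "norm (y - x)"]) (simp add: c_eq mult.commute)
  finally have r_lim: "((\<lambda>t. r (c t) / t) \<longlongrightarrow> 0) (at_right 0)"
    by (rule smalloD_tendsto)
  have "(c has_vector_derivative (y - x)) (at 0 within {0<..})"
    unfolding c_eq[abs_def] by (auto intro!: derivative_eq_intros)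
  moreover have "(H has_derivative (\<lambda>v. inner g v)) (at (c 0))"
    using der by (simp add: c_eq gderiv_def inner_commute)
  ultimately have "((\<lambda>t. H (c t)) has_vector_derivative inner g (y - x)) (at 0 within {0<..})"
    using vector_derivative_diff_chain_within[of c "y - x" 0 "{0<..}" H "inner g"]
    by (auto simp: o_def intro: has_derivative_at_withinI)
  then have H_lim: "((\<lambda>t. (H (c t) - H x) / t) \<longlongrightarrow> inner g (y - x)) (at_right 0)"
    by (simp add: has_real_derivative_iff_has_vector_derivative[symmetric] has_field_derivative_iff c_eq)
  have small: "\<forall>\<^sub>F t in at_right 0. (0::real) < t \<and> t < 1"
    by (rule eventually_at_rightI[of 0 1]) auto
  have "((\<lambda>t. r (c t) / t + \<rho> * ((H (c t) - H x) / t)) \<longlongrightarrow> 0 + \<rho> * inner g (y - x)) (at_right 0)"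
    by (intro tendsto_intros r_lim H_lim)
  moreover have "\<forall>\<^sub>F t in at_right 0.
      r (c t) / t + \<rho> * ((H (c t) - H x) / t) \<le> F y + \<rho> * H y - F x - \<rho> * H x"
    using ev small
  proof eventually_elim
    case (elim t)
    have "F x + r (c t) \<le> F (c t)"
      using elim by (simp add: c_def)
    moreover have "F (c t) + \<rho> * H (c t) \<le> (1 - t) * (F x + \<rho> * H x) + t * (F y + \<rho> * H y)"
      using conv[of t] elim by (simp add: c_def)
    \<comment> \<open>The terms of order 1 cancel, so the right side carries a factor
      \<open>t\<close> and the division leaves a constant bound.\<close>
    ultimately have "r (c t) + \<rho> * (H (c t) - H x) \<le> t * (F y + \<rho> * H y - F x - \<rho> * H x)"
      by (simp add: algebra_simps)
    with elim have "(r (c t) + \<rho> * (H (c t) - H x)) / t \<le> F y + \<rho> * H y - F x - \<rho> * H x"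
      by (simp add: pos_divide_le_eq mult.commute)
    then show ?case
      by (simp add: add_divide_distrib)
  qed
  ultimately have "0 + \<rho> * inner g (y - x) \<le> F y + \<rho> * H y - F x - \<rho> * H x"
    by (rule tendsto_upperbound) simp
  then show ?thesis
    by (simp add: algebra_simps)
qed

lemma GDERIV_grad:
  assumes "continuously_differentiable_on_int_dom h" "x \<in> interior (eff_dom h)"
  shows "GDERIV (\<lambda>y. real_of_ereal (h y)) x :> grad h x"
proof -
  have "\<exists>g. GDERIV (\<lambda>y. real_of_ereal (h y)) x :> g"
    using assms by (simp add: continuously_differentiable_on_int_dom_def)
  then show ?thesis
    unfolding grad_def by (rule someI_ex)
qed

lemma finite_on_eff_dom:
  assumes "proper_fun h" "x \<in> eff_dom h"
  shows "\<bar>h x\<bar> \<noteq> \<infinity>"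
  using assms by (auto simp: proper_fun_def eff_dom_def)

text \<open>Transfers the real inequality to extended values: \<open>f\<close> and \<open>h\<close>
  are finite on \<open>X\<close>, and convexity of \<open>X\<close> keeps the segment where the
  indicator vanishes.\<close>

lemma stationary_point_bregman:
  fixes f h :: "'a::real_inner \<Rightarrow> ereal"
  assumes h: "proper_fun h" "continuously_differentiable_on_int_dom h"
    and X: "X \<subseteq> interior (eff_dom h)" "convex X"
    and wc: "relatively_weakly_convex \<rho> h f"
    and fin: "\<And>z. z \<in> X \<Longrightarrow> \<bar>f z\<bar> \<noteq> \<infinity>"
    and stat: "stationary_point f X x"
    and xy: "x \<in> X" "y \<in> X"
  shows "f x - f y \<le> ereal \<rho> * bregman h y x"
proof -
  define F where "F = (\<lambda>z. real_of_ereal (f z))"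
  define H where "H = (\<lambda>z. real_of_ereal (h z))"
  have f_eq: "f z = ereal (F z)" if "z \<in> X" for z
    using fin[OF that] by (simp add: F_def ereal_real')
  have h_eq: "h z = ereal (H z)" if "z \<in> X" for z
    using finite_on_eff_dom[OF h(1), of z] that X(1) interior_subset[of "eff_dom h"]
    by (auto simp: H_def ereal_real')
  have "F x - F y \<le> \<rho> * (H y - H x - inner (grad h x) (y - x))"
  \<comment> \<open>\<open>at x\<close> is a punctured filter, which a constant segment does not
    approach; for \<open>x = y\<close> both sides are 0.\<close>
  proof (cases "x = y")
    case False
    have seg: "(1 - t) *\<^sub>R x + t *\<^sub>R y \<in> X" if "0 < t" "t < 1" for t
      using convexD_alt[OF X(2) xy, of t] that by simp
    obtain r where r: "r \<in> o[at x](\<lambda>z. norm (z - x))"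
      and ev: "\<forall>\<^sub>F z in at x. f z + indicator_fun X z \<ge> f x + indicator_fun X x + ereal (r z)"
      using stat by (auto simp: stationary_point_def frechet_subdifferential_def)
    have small: "\<forall>\<^sub>F t in at_right 0. (0::real) < t \<and> t < 1"
      by (rule eventually_at_rightI[of 0 1]) auto
    have "((\<lambda>t. (1 - t) *\<^sub>R x + t *\<^sub>R y) \<longlongrightarrow> (1 - 0) *\<^sub>R x + 0 *\<^sub>R y) (at_right (0::real))"
      by (intro tendsto_intros)
    moreover have "\<forall>\<^sub>F t in at_right 0. (1 - t) *\<^sub>R x + t *\<^sub>R y \<noteq> x"
      using small
    proof eventually_elim
      case (elim t)
      have "(1 - t) *\<^sub>R x + t *\<^sub>R y - x = t *\<^sub>R (y - x)"
        by (simp add: algebra_simps)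
      with elim False show ?case
        by (metis eq_iff_diff_eq_0 less_irrefl scaleR_eq_0_iff)
    qed
    ultimately have lim: "filterlim (\<lambda>t. (1 - t) *\<^sub>R x + t *\<^sub>R y) (at x) (at_right (0::real))"
      by (simp add: filterlim_at)
    show ?thesis
    proof (rule stationary_segment_real[OF _ _ r _ lim])
      show "GDERIV H x :> grad h x"
        using GDERIV_grad[OF h(2)] xy X unfolding H_def by blast
      show "\<forall>\<^sub>F t in at_right 0. F ((1 - t) *\<^sub>R x + t *\<^sub>R y) \<ge> F x + r ((1 - t) *\<^sub>R x + t *\<^sub>R y)"
        using filterlim_iff[THEN iffD1, OF lim, rule_format, OF ev] small
      proof eventually_elim
        case (elim t)
        then show ?case
          \<comment> \<open>Both \<open>x\<close> and the segment point lie in \<open>X\<close>, so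
            both indicator terms are 0.\<close>
          using seg[of t] xy by (simp add: indicator_fun_def f_eq)
      qed
    next
      fix t :: real
      assume t: "0 < t" "t < 1"
      let ?z = "(1 - t) *\<^sub>R x + t *\<^sub>R y"
      have "f ?z + ereal \<rho> * h ?z
          \<le> ereal (1 - t) * (f x + ereal \<rho> * h x) + ereal t * (f y + ereal \<rho> * h y)"
        using wc t xy X(1) unfolding relatively_weakly_convex_def econvex_on_def by blast
      then show "F ?z + \<rho> * H ?z \<le> (1 - t) * (F x + \<rho> * H x) + t * (F y + \<rho> * H y)"
        using seg[OF t] xy by (simp add: f_eq h_eq)
    qed
  qed simp
  with xy show ?thesis
    by (simp add: f_eq h_eq bregman_def)
qed

lemma infdist_proj_set:
  assumes "y \<in> proj_set S x"
  shows "y \<in> S" "infdist x S = dist y x"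
proof -
  from assms have y: "y \<in> S" "\<And>z. z \<in> S \<Longrightarrow> dist y x \<le> dist z x"
    by (auto simp: proj_set_def is_arg_min_linorder)
  show "y \<in> S" by fact
  show "infdist x S = dist y x"
    using y infdist_le[OF y(1), of x]
    by (intro antisym) (auto simp: infdist_def dist_commute intro!: cINF_greatest)
qed

theorem proposition3p13:
  fixes h f :: "real ^ 'n \<Rightarrow> ereal" and X :: "(real ^ 'n) set"
    and \<rho> \<mu> \<nu> G :: real and x :: "real ^ 'n"
  assumes "legendre_kernel h"
    and "X \<subseteq> interior (eff_dom h)" and "X \<noteq> {}" and "closed X" and "convex X"
    and "proper_fun f"
    and "\<rho> > 0" and "relatively_weakly_convex \<rho> h f"
    and "\<forall>z\<in>X. finite_locally_lipschitz_at f z"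
    and "opt_value f X > -\<infinity>" and "sol_set f X \<noteq> {}"
    and "\<mu> > 0" and "sharp \<mu> f X"
    and "0 < \<nu>" and "\<nu> \<le> 1" and "G > 0" and "local_bregman_growth h f X \<rho> \<mu> \<nu> G"
    and "x \<in> tube f X \<rho> \<mu> \<nu> G"
    and "stationary_point f X x"
  shows "x \<in> sol_set f X"
proof (rule ccontr)
  assume notin: "x \<notin> sol_set f X"
  define d where "d = infdist x (sol_set f X)"
  define P where "P = proj_set (sol_set f X) x"
  have xX: "x \<in> X" and d_less: "d < (\<mu> / (\<rho> * G)) powr (1 / \<nu>)"
    using \<open>x \<in> tube f X \<rho> \<mu> \<nu> G\<close> by (auto simp: tube_def d_def)
  \<comment> \<open>Local Lipschitz continuity includes finiteness on a ball, in particular at its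
    centre.\<close>
  have fin: "\<bar>f z\<bar> \<noteq> \<infinity>" if "z \<in> X" for z
    using \<open>\<forall>z\<in>X. finite_locally_lipschitz_at f z\<close> that
    by (metis finite_locally_lipschitz_at_def centre_in_ball)
  have growth: "(INF y\<in>P. bregman h y x) \<le> ereal (G * d powr (1 + \<nu>))"
    using \<open>local_bregman_growth h f X \<rho> \<mu> \<nu> G\<close> \<open>x \<in> tube f X \<rho> \<mu> \<nu> G\<close>
    by (auto simp: local_bregman_growth_def d_def P_def)
  \<comment> \<open>An infimum over the empty set is \<open>\<infinity>\<close>, so the growth bound itself yields a projection.\<close>
  then have "P \<noteq> {}"
    by (auto simp: top_ereal_def)
  then obtain y where "y \<in> P" by blast
  then have "y \<in> sol_set f X" "d = dist y x"
    using infdist_proj_set by (auto simp: P_def d_def)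
  \<comment> \<open>The distance is attained at a solution \<open>y\<close>, which differs from
    \<open>x\<close>.\<close>
  with notin have "d > 0" by auto
  \<comment> \<open>The growth condition bounds only the infimum over \<open>P\<close>, so the lower
    bound is proved for every projection and then passed to the infimum.\<close>
  have "ereal (\<mu> * d / \<rho>) \<le> bregman h z x" if "z \<in> P" for z
  proof -
    have z: "z \<in> X" "f z = opt_value f X"
      using infdist_proj_set(1)[of z "sol_set f X" x] that by (auto simp: P_def sol_set_def)
    have "ereal (\<mu> * d) \<le> f x - f z"
      using \<open>sharp \<mu> f X\<close> xX z by (auto simp: sharp_def d_def)
    also have "\<dots> \<le> ereal \<rho> * bregman h z x"
      using assms xX z(1) fin
      by (intro stationary_point_bregman[of h X]) (auto simp: legendre_kernel_def)
    finally show ?thesis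
      using \<open>\<rho> > 0\<close>
      \<comment> \<open>The value -\<infinity> contradicts the chain above since
        \<open>\<rho> > 0\<close>, and \<infinity> is trivial.\<close>
      by (cases "bregman h z x") (auto simp: pos_divide_le_eq mult.commute)
  qed
  then have "ereal (\<mu> * d / \<rho>) \<le> (INF z\<in>P. bregman h z x)"
    by (rule INF_greatest)
  also note growth
  finally have "\<mu> * d / \<rho> \<le> G * (d * d powr \<nu>)"
    using \<open>d > 0\<close> by (simp add: powr_add)
  \<comment> \<open>Cancelling one factor \<open>d > 0\<close> leaves \<open>d powr \<nu>\<close> at
    least the threshold; raising the tube bound to the power \<nu> puts it strictly below.\<close>
  then have "\<mu> / (\<rho> * G) \<le> d powr \<nu>"
    using \<open>d > 0\<close> \<open>\<rho> > 0\<close> \<open>G > 0\<close> by (simp add: field_simps)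
  also have "\<dots> < ((\<mu> / (\<rho> * G)) powr (1 / \<nu>)) powr \<nu>"
    using d_less \<open>d > 0\<close> \<open>0 < \<nu>\<close> by (intro powr_less_mono2) auto
  also have "\<dots> = \<mu> / (\<rho> * G)"
    using assms by (simp add: powr_powr)
  finally show False by simp
qed

end
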